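(* Let $\alpha: I\to E^3$ be a Frenet curve with Frenet frame $\{T,N,B\}$, and let $\beta$ be a Bertrand-direction curve of $\alpha$ with Frenet frame $\{\overline T,\overline N,\overline B\}$. Then there is a constant $\theta\in\mathbb{R}$ (the constant oriented angle between the tangent lines of the two curves) such that $$\overline T(s)=\cos\theta\,T(s)+\sin\theta\,B(s),\qquad \overline N(s)=N(s),\qquad \overline B(s)=-\sin\theta\,T(s)+\cos\theta\,B(s).$$
   Context: $I\subset\mathbb{R}$ is an open interval and curves are smooth. A unit speed curve $\alpha:I\to E^3$ is a Frenet curve if its curvature $\kappa=\|\alpha''\|$ is nowhere zero; then $T=\alpha'$, $N=\alpha''/\kappa$, $B=T\times N$, and $T'=\kappa N$, $N'=-\kappa T+\tau B$, $B'=-\tau N$, where $\tau$ is the torsion. For a unit vector field $X(s)=a(s)T(s)+b(s)N(s)+c(s)B(s)$ with $a,b,c$ smooth and $a^2+b^2+c^2=1$, an $X$-direction curve of $\alpha$ is a curve $\beta:I\to E^3$ with $\beta'(s)=X(s)$; the parameter $s$ is then also arc length for $\beta$. The Frenet vectors of $\beta$ are defined in the same way ($\overline T=\beta'$, $\overline\kappa=\|\beta''\|$, $\overline N=\beta''/\overline\kappa$, $\overline B=\overline T\times\overline N$). An $X$-direction curve $\beta$ of $\alpha$ (for some such $X$) is called a Bertrand-direction curve of $\alpha$ if $\beta$ is a Bertrand curve of $\alpha$ (and $\alpha$ a Bertrand partner curve of $\beta$), in the sense that $\beta$ is a Frenet curve with $\overline N=N$ at each common parameter value $s$. *)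

theory Defs
  imports "HOL-Analysis.Analysis"
begin

text \<open>
  A curve on an open interval \<open>I\<close> is represented by a total function on \<open>real\<close>. All derivatives
  are two-sided and taken at points of the open set \<open>I\<close> only, so the values of the function
  outside \<open>I\<close> are irrelevant.
\<close>

definition curve_deriv :: "(real \<Rightarrow> 'a::real_normed_vector) \<Rightarrow> real \<Rightarrow> 'a" where
  "curve_deriv f s = vector_derivative f (at s)"

definition smooth_curve_on :: "real set \<Rightarrow> (real \<Rightarrow> 'a::real_normed_vector) \<Rightarrow> bool" where
  "smooth_curve_on I f \<longleftrightarrow> (\<forall>n. \<forall>s\<in>I. ((curve_deriv ^^ n) f) differentiable (at s))"

definition unit_speed_curve :: "real set \<Rightarrow> (real \<Rightarrow> real^3) \<Rightarrow> bool" where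
  "unit_speed_curve I \<alpha> \<longleftrightarrow> smooth_curve_on I \<alpha> \<and> (\<forall>s\<in>I. norm (curve_deriv \<alpha> s) = 1)"

definition curvature :: "(real \<Rightarrow> real^3) \<Rightarrow> real \<Rightarrow> real" where
  "curvature \<alpha> s = norm (curve_deriv (curve_deriv \<alpha>) s)"

definition frenet_curve :: "real set \<Rightarrow> (real \<Rightarrow> real^3) \<Rightarrow> bool" where
  "frenet_curve I \<alpha> \<longleftrightarrow> unit_speed_curve I \<alpha> \<and> (\<forall>s\<in>I. curvature \<alpha> s \<noteq> 0)"

definition frenet_T :: "(real \<Rightarrow> real^3) \<Rightarrow> real \<Rightarrow> real^3" where
  "frenet_T \<alpha> s = curve_deriv \<alpha> s"

definition frenet_N :: "(real \<Rightarrow> real^3) \<Rightarrow> real \<Rightarrow> real^3" where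
  "frenet_N \<alpha> s = curve_deriv (curve_deriv \<alpha>) s /\<^sub>R curvature \<alpha> s"

definition frenet_B :: "(real \<Rightarrow> real^3) \<Rightarrow> real \<Rightarrow> real^3" where
  "frenet_B \<alpha> s = cross3 (frenet_T \<alpha> s) (frenet_N \<alpha> s)"

definition unit_field_along :: "real set \<Rightarrow> (real \<Rightarrow> real^3) \<Rightarrow> (real \<Rightarrow> real^3) \<Rightarrow> bool" where
  "unit_field_along I \<alpha> X \<longleftrightarrow>
     (\<exists>a b c :: real \<Rightarrow> real.
        smooth_curve_on I a \<and> smooth_curve_on I b \<and> smooth_curve_on I c \<and>
        (\<forall>s\<in>I. (a s)\<^sup>2 + (b s)\<^sup>2 + (c s)\<^sup>2 = 1 \<and>
                X s = a s *\<^sub>R frenet_T \<alpha> s + b s *\<^sub>R frenet_N \<alpha> s + c s *\<^sub>R frenet_B \<alpha> s))"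

definition direction_curve ::
  "real set \<Rightarrow> (real \<Rightarrow> real^3) \<Rightarrow> (real \<Rightarrow> real^3) \<Rightarrow> (real \<Rightarrow> real^3) \<Rightarrow> bool" where
  "direction_curve I \<alpha> X \<beta> \<longleftrightarrow>
     unit_field_along I \<alpha> X \<and> smooth_curve_on I \<beta> \<and>
     (\<forall>s\<in>I. (\<beta> has_vector_derivative X s) (at s))"

definition bertrand_curve_of :: "real set \<Rightarrow> (real \<Rightarrow> real^3) \<Rightarrow> (real \<Rightarrow> real^3) \<Rightarrow> bool" where
  "bertrand_curve_of I \<alpha> \<beta> \<longleftrightarrow>
     frenet_curve I \<beta> \<and> (\<forall>s\<in>I. frenet_N \<beta> s = frenet_N \<alpha> s)"

definition bertrand_direction_curve :: "real set \<Rightarrow> (real \<Rightarrow> real^3) \<Rightarrow> (real \<Rightarrow> real^3) \<Rightarrow> bool" where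
  "bertrand_direction_curve I \<alpha> \<beta> \<longleftrightarrow>
     (\<exists>X. direction_curve I \<alpha> X \<beta>) \<and> bertrand_curve_of I \<alpha> \<beta>"

end

theory Submission
  imports Defs
begin

text \<open>
  Along a Bertrand pair the tangent fields \<open>T\<close> and \<open>U\<close> of the two curves have derivatives that
  are both multiples of the common principal normal \<open>N\<close>, while \<open>N\<close> is orthogonal to \<open>T\<close> and
  to \<open>U\<close>. Hence \<open>U\<close> lies in the plane of \<open>T\<close> and \<open>B\<close>, and its two coordinates there are
  constant. The coordinate \<open>T \<bullet> U\<close> is constant by the product rule alone
  (\<open>inner_tangents_deriv_zero\<close>). For \<open>B \<bullet> U\<close> the product rule leaves only the triple product
  of \<open>T\<close>, \<open>N'\<close> and \<open>U\<close>, which vanishes because all three vectors are orthogonal to \<open>N\<close>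
  (\<open>inner_binormal_tangent_deriv_zero\<close>). As \<open>U\<close> is a unit
  vector, the two constants are the cosine and the sine of one angle, and the formula for the
  second binormal follows by taking the cross product with \<open>N\<close>.
\<close>

lemma frenet_tangent_has_vector_derivative:
  assumes "frenet_curve I \<alpha>" and "s \<in> I"
  shows "(frenet_T \<alpha> has_vector_derivative curvature \<alpha> s *\<^sub>R frenet_N \<alpha> s) (at s)"
proof -
  have "((curve_deriv ^^ 1) \<alpha>) differentiable (at s)"
    using assms unfolding frenet_curve_def unit_speed_curve_def smooth_curve_on_def by blast
  then have "(curve_deriv \<alpha> has_vector_derivative curve_deriv (curve_deriv \<alpha>) s) (at s)"
    by (simp add: curve_deriv_def vector_derivative_works)
  moreover have "curvature \<alpha> s \<noteq> 0"
    using assms by (simp add: frenet_curve_def)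
  moreover have "frenet_T \<alpha> = curve_deriv \<alpha>"
    by (simp add: fun_eq_iff frenet_T_def)
  ultimately show ?thesis
    by (simp add: frenet_N_def)
qed

lemma norm_frenet_T:
  assumes "frenet_curve I \<alpha>" and "s \<in> I"
  shows "norm (frenet_T \<alpha> s) = 1"
  using assms by (simp add: frenet_curve_def unit_speed_curve_def frenet_T_def)

lemma norm_frenet_N:
  assumes "frenet_curve I \<alpha>" and "s \<in> I"
  shows "norm (frenet_N \<alpha> s) = 1"
  using assms by (auto simp: frenet_curve_def frenet_N_def curvature_def)

text \<open>
  The norm is differentiable away from the origin, so a curvature without zeros is
  differentiable, and so is the quotient by it.
\<close>

lemma frenet_N_differentiable:
  assumes "frenet_curve I \<alpha>" and "s \<in> I"
  shows "frenet_N \<alpha> differentiable (at s)"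
proof -
  have "((curve_deriv ^^ 2) \<alpha>) differentiable (at s)"
    using assms unfolding frenet_curve_def unit_speed_curve_def smooth_curve_on_def by blast
  then have d: "curve_deriv (curve_deriv \<alpha>) differentiable (at s)"
    by (simp add: numeral_2_eq_2)
  have "curve_deriv (curve_deriv \<alpha>) s \<noteq> 0"
    using assms by (auto simp: frenet_curve_def curvature_def)
  then have "(\<lambda>t. inverse (norm (curve_deriv (curve_deriv \<alpha>) t))
                  *\<^sub>R curve_deriv (curve_deriv \<alpha>) t) differentiable (at s)"
    using d differentiable_compose[OF differentiable_norm_at d]
    by (intro differentiable_scaleR differentiable_inverse) auto
  moreover have "frenet_N \<alpha> = (\<lambda>t. inverse (norm (curve_deriv (curve_deriv \<alpha>) t))
                  *\<^sub>R curve_deriv (curve_deriv \<alpha>) t)"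
    by (simp add: fun_eq_iff frenet_N_def curvature_def)
  ultimately show ?thesis by simp
qed

text \<open>
  Differentiating the constant \<open>v \<bullet> v\<close>. Openness of the set makes the two-sided derivative
  depend only on values at points where the norm is known.
\<close>

lemma unit_field_orthogonal_deriv:
  fixes v :: "real \<Rightarrow> 'a::real_inner"
  assumes "open I" and "s \<in> I" and unit: "\<And>t. t \<in> I \<Longrightarrow> norm (v t) = 1"
    and d: "(v has_vector_derivative v') (at s)"
  shows "v s \<bullet> v' = 0"
proof -
  have "((\<lambda>t. v t \<bullet> v t) has_vector_derivative v s \<bullet> v' + v' \<bullet> v s) (at s)"
    by (rule bounded_bilinear.has_vector_derivative[OF bounded_bilinear_inner d d])
  moreover have "((\<lambda>t. v t \<bullet> v t) has_vector_derivative 0) (at s)"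
    by (rule has_vector_derivative_transform_within_open[of "\<lambda>_. 1" _ _ I])
       (use assms in \<open>auto simp: dot_square_norm\<close>)
  ultimately have "v s \<bullet> v' + v' \<bullet> v s = 0"
    by (rule vector_derivative_unique_at)
  then show ?thesis
    by (simp add: inner_commute)
qed

lemma frenet_T_orthogonal_N:
  assumes "open I" and "frenet_curve I \<alpha>" and "s \<in> I"
  shows "frenet_T \<alpha> s \<bullet> frenet_N \<alpha> s = 0"
proof -
  have "frenet_T \<alpha> s \<bullet> (curvature \<alpha> s *\<^sub>R frenet_N \<alpha> s) = 0"
    using assms norm_frenet_T frenet_tangent_has_vector_derivative
    by (intro unit_field_orthogonal_deriv[of I]) auto
  then show ?thesis
    using assms by (simp add: frenet_curve_def)
qed

text \<open>
  The remainder after subtracting the two components is orthogonal to \<open>T\<close>, \<open>N\<close> and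
  \<open>T \<times> N\<close>. Its inner and cross product with \<open>T \<times> N\<close> both vanish, so it is zero.
\<close>

lemma orthogonal_to_normal_decomposition:
  fixes T N U :: "real^3"
  assumes T: "norm T = 1" and N: "norm N = 1" and TN: "T \<bullet> N = 0" and UN: "U \<bullet> N = 0"
  shows "U = (T \<bullet> U) *\<^sub>R T + (cross3 T N \<bullet> U) *\<^sub>R cross3 T N"
proof -
  define W where "W = U - (T \<bullet> U) *\<^sub>R T - (cross3 T N \<bullet> U) *\<^sub>R cross3 T N"
  have BB: "cross3 T N \<bullet> cross3 T N = 1"
    using T N TN unfolding dot_cross by (simp add: dot_square_norm)
  have "W \<bullet> T = 0"
    using T by (simp add: W_def inner_diff_left inner_diff_right dot_square_norm dot_cross_self inner_commute)
  moreover have "W \<bullet> N = 0"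
    using TN UN by (simp add: W_def inner_diff_left dot_cross_self)
  moreover have "W \<bullet> cross3 T N = 0"
    using BB by (simp add: W_def inner_diff_left inner_diff_right dot_cross_self inner_commute)
  ultimately have "W \<bullet> cross3 T N = 0 \<and> cross3 W (cross3 T N) = 0"
    by (simp add: Lagrange)
  then have "W = 0"
    using BB by (auto simp: norm_and_cross_eq_0)
  then show ?thesis
    by (simp add: W_def algebra_simps)
qed

lemma inner_tangents_deriv_zero:
  assumes "(T has_vector_derivative k *\<^sub>R N) (at s)"
    and "(U has_vector_derivative l *\<^sub>R N) (at s)"
    and "T s \<bullet> N = 0" and "U s \<bullet> N = 0"
  shows "((\<lambda>t. T t \<bullet> U t) has_vector_derivative 0) (at s)"
  using bounded_bilinear.has_vector_derivative[OF bounded_bilinear_inner assms(1,2)] assms(3,4)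
  by (simp add: inner_commute)

text \<open>
  After the terms with \<open>T'\<close> and \<open>U'\<close> have vanished, \<open>(T \<times> N') \<bullet> U\<close> remains. Since \<open>U\<close> is a
  combination of \<open>T\<close> and \<open>T \<times> N\<close>, it suffices to pair \<open>T \<times> N'\<close> with these two; the second
  pairing reduces to \<open>N' \<bullet> N = 0\<close>.
\<close>

lemma inner_binormal_tangent_deriv_zero:
  fixes T N U :: "real \<Rightarrow> real^3"
  assumes T: "(T has_vector_derivative k *\<^sub>R N s) (at s)"
    and U: "(U has_vector_derivative l *\<^sub>R N s) (at s)"
    and N: "(N has_vector_derivative N') (at s)"
    and unit: "norm (T s) = 1" "norm (N s) = 1"
    and orth: "T s \<bullet> N s = 0" "U s \<bullet> N s = 0" "N s \<bullet> N' = 0"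
  shows "((\<lambda>t. cross3 (T t) (N t) \<bullet> U t) has_vector_derivative 0) (at s)"
proof -
  have "bounded_bilinear cross3"
    using bilinear_cross bilinear_conv_bounded_bilinear by blast
  \<comment> \<open>The term \<open>T' \<times> N\<close> of the product rule drops out, as \<open>T'\<close> is parallel to \<open>N\<close>.\<close>
  have B: "((\<lambda>t. cross3 (T t) (N t)) has_vector_derivative cross3 (T s) N') (at s)"
    using bounded_bilinear.has_vector_derivative[OF \<open>bounded_bilinear cross3\<close> T N]
    by (simp add: cross_mult_left)
  have "cross3 (T s) N' \<bullet> T s = 0"
    by (simp add: dot_cross_self)
  moreover have "cross3 (T s) N' \<bullet> cross3 (T s) (N s) = 0"
    using orth by (simp add: dot_cross inner_commute)
  ultimately have "cross3 (T s) N' \<bullet> ((T s \<bullet> U s) *\<^sub>R T s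
      + (cross3 (T s) (N s) \<bullet> U s) *\<^sub>R cross3 (T s) (N s)) = 0"
    by (simp add: inner_add_right)
  then have "cross3 (T s) N' \<bullet> U s = 0"
    by (simp only: orthogonal_to_normal_decomposition[OF unit orth(1,2), symmetric])
  then show ?thesis
    using bounded_bilinear.has_vector_derivative[OF bounded_bilinear_inner B U]
    by (simp add: dot_cross_self)
qed

theorem corollary5p4:
  fixes I :: "real set" and \<alpha> \<beta> :: "real \<Rightarrow> real^3"
  assumes "open I" and "is_interval I"
    and "frenet_curve I \<alpha>"
    and "bertrand_direction_curve I \<alpha> \<beta>"
  shows "\<exists>\<theta>::real. \<forall>s\<in>I.
           frenet_T \<beta> s = cos \<theta> *\<^sub>R frenet_T \<alpha> s + sin \<theta> *\<^sub>R frenet_B \<alpha> s \<and>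
           frenet_N \<beta> s = frenet_N \<alpha> s \<and>
           frenet_B \<beta> s = - sin \<theta> *\<^sub>R frenet_T \<alpha> s + cos \<theta> *\<^sub>R frenet_B \<alpha> s"
proof (cases "I = {}")
  case True
  then show ?thesis by simp
next
  case False
  then obtain s0 where s0: "s0 \<in> I" by blast
  note \<alpha> = assms(3)
  have \<beta>: "frenet_curve I \<beta>" and NN: "\<And>s. s \<in> I \<Longrightarrow> frenet_N \<beta> s = frenet_N \<alpha> s"
    using assms(4) by (auto simp: bertrand_direction_curve_def bertrand_curve_of_def)
  have "convex I"
    using assms(2) is_interval_convex by blast
  let ?T = "frenet_T \<alpha>" and ?N = "frenet_N \<alpha>" and ?B = "frenet_B \<alpha>" and ?U = "frenet_T \<beta>"
  have TN: "?T s \<bullet> ?N s = 0" and UN: "?U s \<bullet> ?N s = 0" if "s \<in> I" for s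
    using frenet_T_orthogonal_N[OF assms(1) \<alpha> that] frenet_T_orthogonal_N[OF assms(1) \<beta> that]
      NN[OF that] by simp_all
  have dT: "(?T has_vector_derivative curvature \<alpha> s *\<^sub>R ?N s) (at s)"
    and dU: "(?U has_vector_derivative curvature \<beta> s *\<^sub>R ?N s) (at s)" if "s \<in> I" for s
    using frenet_tangent_has_vector_derivative[OF \<alpha> that]
      frenet_tangent_has_vector_derivative[OF \<beta> that] NN[OF that] by simp_all
  have "((\<lambda>t. ?T t \<bullet> ?U t) has_vector_derivative 0) (at s within I)" if "s \<in> I" for s
    by (rule has_vector_derivative_at_within)
       (rule inner_tangents_deriv_zero[OF dT dU TN UN], (rule that)+)
  then obtain c where c: "\<And>s. s \<in> I \<Longrightarrow> ?T s \<bullet> ?U s = c"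
    by (rule has_vector_derivative_zero_constant[OF \<open>convex I\<close>, where f = "\<lambda>t. ?T t \<bullet> ?U t"]) blast+
  have "((\<lambda>t. ?B t \<bullet> ?U t) has_vector_derivative 0) (at s within I)" if "s \<in> I" for s
  proof -
    have dN: "(?N has_vector_derivative vector_derivative ?N (at s)) (at s)"
      using frenet_N_differentiable[OF \<alpha> that] by (simp add: vector_derivative_works)
    have "?N s \<bullet> vector_derivative ?N (at s) = 0"
      using unit_field_orthogonal_deriv[OF assms(1) that norm_frenet_N[OF \<alpha>] dN] .
    then have "((\<lambda>t. cross3 (?T t) (?N t) \<bullet> ?U t) has_vector_derivative 0) (at s)"
      by (intro inner_binormal_tangent_deriv_zero[where N = ?N, OF dT dU dN] norm_frenet_T[OF \<alpha>]
          norm_frenet_N[OF \<alpha>] TN UN that)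
    then show ?thesis
      by (simp add: frenet_B_def has_vector_derivative_at_within)
  qed
  then obtain f where f: "\<And>s. s \<in> I \<Longrightarrow> ?B s \<bullet> ?U s = f"
    by (rule has_vector_derivative_zero_constant[OF \<open>convex I\<close>, where f = "\<lambda>t. ?B t \<bullet> ?U t"]) blast+
  have U: "?U s = c *\<^sub>R ?T s + f *\<^sub>R ?B s" if "s \<in> I" for s
    using orthogonal_to_normal_decomposition[OF norm_frenet_T[OF \<alpha> that] norm_frenet_N[OF \<alpha> that]
        TN[OF that] UN[OF that]]
    unfolding frenet_B_def[symmetric] c[OF that] f[OF that] .
  \<comment> \<open>Pairing the decomposition of \<open>U\<close> with \<open>U\<close> itself turns its length into \<open>c\<^sup>2 + f\<^sup>2\<close>.\<close>
  have "?U s0 \<bullet> ?U s0 = c * (?T s0 \<bullet> ?U s0) + f * (?B s0 \<bullet> ?U s0)"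
    by (subst (1) U[OF s0]) (simp only: inner_add_left inner_scaleR_left)
  then have "c\<^sup>2 + f\<^sup>2 = 1"
    using c[OF s0] f[OF s0] norm_frenet_T[OF \<beta> s0]
    by (simp add: dot_square_norm power2_eq_square)
  then obtain \<theta> where \<theta>: "c = cos \<theta>" "f = sin \<theta>"
    using sincos_total_2pi by metis
  have "frenet_B \<beta> s = - sin \<theta> *\<^sub>R ?T s + cos \<theta> *\<^sub>R ?B s" if "s \<in> I" for s
  proof -
    have "cross3 (?B s) (?N s) = - cross3 (?N s) (cross3 (?T s) (?N s))"
      unfolding frenet_B_def by (rule cross_skew)
    also have "\<dots> = - ?T s"
      using TN[OF that] norm_frenet_N[OF \<alpha> that]
      by (simp add: Lagrange dot_square_norm inner_commute)
    finally have BN: "cross3 (?B s) (?N s) = - ?T s" .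
    have "frenet_B \<beta> s = cross3 (cos \<theta> *\<^sub>R ?T s + sin \<theta> *\<^sub>R ?B s) (?N s)"
      using U[OF that] NN[OF that] \<theta> by (simp add: frenet_B_def)
    also have "\<dots> = cos \<theta> *\<^sub>R ?B s + sin \<theta> *\<^sub>R cross3 (?B s) (?N s)"
      by (simp add: cross_add_left cross_mult_left frenet_B_def)
    finally show ?thesis
      by (simp add: BN)
  qed
  then show ?thesis
    using U NN \<theta> by blast
qed

end
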